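(* Let $E$ be an arbitrary directed graph. Then: (i) $P_{ppi}$ is a hereditary and saturated set. (ii) $P_{ec}\subseteq P_{ppi}$.
   Context: A directed graph $E=(E^0,E^1,s,r)$ consists of arbitrary sets $E^0$ (vertices), $E^1$ (edges) and maps $s,r:E^1\to E^0$ (source, range). A vertex $v$ is a sink if $s^{-1}(v)=\emptyset$, an infinite emitter if $s^{-1}(v)$ is infinite, and regular otherwise. A path is a vertex (length $0$) or a finite sequence of edges $e_1\cdots e_n$ with $r(e_i)=s(e_{i+1})$. Write $u\ge v$ if there is a path from $u$ to $v$, and $T(v)=\{u\in E^0: v\ge u\}$. A set $H\subseteq E^0$ is hereditary if $v\in H$, $v\ge w$ imply $w\in H$; it is saturated if for every regular vertex $v$, $r(s^{-1}(v))\subseteq H$ implies $v\in H$. $\overline{X}$ denotes the smallest hereditary and saturated subset of $E^0$ containing $X$. ${\rm CSP}(w)$ is the set of closed simple paths based at $w$, i.e. paths $e_1\cdots e_n$, $n>0$, with $s(e_1)=r(e_n)=w$ and $s(e_i)\ne w$ for $i\ge2$. A cycle $c$ is a path $e_1\cdots e_n$, $n>0$, with $r(e_n)=s(e_1)$ and $s(e_i)\ne s(e_j)$ for $i\ne j$; $c^0$ is its set of vertices. An exit for it is an edge $e$ with $s(e)=s(e_i)$, $e\neq e_i$ for some $i$. A cycle $c$ is extreme if it has exits and for every path $\lambda$ starting at a vertex of $c^0$ there is a path $\mu$ with $s(\mu)=r(\lambda)$ and $r(\mu)\in c^0$. $P_{ec}$ is the set of vertices belonging to extreme cycles. A vertex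 $v$ is properly infinite if there exist vertices $w_1,\dots,w_n\in T(v)$ with $|{\rm CSP}(w_i)|\ge 2$ for all $i$ and $v\in\overline{\{w_1,\dots,w_n\}}$. $P_{pi}$ is the set of properly infinite vertices. For a hereditary saturated $H\subseteq E^0$, $B_H=\{v\in E^0\setminus H: v \text{ is an infinite emitter and } 0<|s^{-1}(v)\cap r^{-1}(E^0\setminus H)|<\infty\}$; a breaking vertex is a vertex lying in $B_H$ for some hereditary saturated $H$. Define $P_{ppi}=\{v\in E^0: T(v)\subseteq P_{pi}\text{ and }T(v)\text{ has no breaking vertices}\}$. *)

theory Defs
  imports "Graph_Theory.Graph_Theory"
begin

text \<open>
  A directed graph is a \<^locale>\<open>wf_digraph\<close>: its vertex and arc sets are
  arbitrary (possibly infinite), and parallel arcs and loops are allowed. Source and range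
  of an arc are \<^const>\<open>tail\<close> and \<^const>\<open>head\<close>, a path from \<open>u\<close> to \<open>v\<close> is an arc walk
  \<open>awalk u p v\<close> (the length-0 path at \<open>u\<close> being \<open>awalk u [] u\<close>), and the preorder
  \<open>u \<ge> v\<close> is reachability.
\<close>

context pre_digraph
begin

definition sink :: "'a \<Rightarrow> bool" where
  "sink v \<longleftrightarrow> v \<in> verts G \<and> out_arcs G v = {}"

definition infinite_emitter :: "'a \<Rightarrow> bool" where
  "infinite_emitter v \<longleftrightarrow> v \<in> verts G \<and> infinite (out_arcs G v)"

definition regular_vertex :: "'a \<Rightarrow> bool" where
  "regular_vertex v \<longleftrightarrow> v \<in> verts G \<and> \<not> sink v \<and> \<not> infinite_emitter v"

definition tree :: "'a \<Rightarrow> 'a set" where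
  "tree v = {u \<in> verts G. v \<rightarrow>\<^sup>*\<^bsub>G\<^esub> u}"

definition hereditary :: "'a set \<Rightarrow> bool" where
  "hereditary H \<longleftrightarrow> H \<subseteq> verts G \<and> (\<forall>v w. v \<in> H \<and> v \<rightarrow>\<^sup>*\<^bsub>G\<^esub> w \<longrightarrow> w \<in> H)"

definition saturated :: "'a set \<Rightarrow> bool" where
  "saturated H \<longleftrightarrow> H \<subseteq> verts G \<and>
     (\<forall>v. regular_vertex v \<and> head G ` out_arcs G v \<subseteq> H \<longrightarrow> v \<in> H)"

definition hs_closure :: "'a set \<Rightarrow> 'a set" where
  "hs_closure X = \<Inter>{H. hereditary H \<and> saturated H \<and> X \<subseteq> H}"

definition CSP :: "'a \<Rightarrow> 'b list set" where
  "CSP w = {p. p \<noteq> [] \<and> awalk w p w \<and> (\<forall>e \<in> set (tl p). tail G e \<noteq> w)}"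

definition cycle_verts :: "'b list \<Rightarrow> 'a set" where
  "cycle_verts c = tail G ` set c"

definition exit_of :: "'b list \<Rightarrow> 'b \<Rightarrow> bool" where
  "exit_of c e \<longleftrightarrow> e \<in> arcs G \<and> (\<exists>e' \<in> set c. tail G e = tail G e' \<and> e \<noteq> e')"

definition extreme_cycle :: "'b list \<Rightarrow> bool" where
  "extreme_cycle c \<longleftrightarrow> cycle c \<and> (\<exists>e. exit_of c e) \<and>
     (\<forall>u p v. u \<in> cycle_verts c \<and> awalk u p v \<longrightarrow>
        (\<exists>q w. awalk v q w \<and> w \<in> cycle_verts c))"

definition P_ec :: "'a set" where
  "P_ec = {v. \<exists>c. extreme_cycle c \<and> v \<in> cycle_verts c}"

text \<open>
  \<open>CSP w\<close> may be infinite, and \<^const>\<open>card\<close> is \<open>0\<close> on infinite sets; hence the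
  extra disjunct.
\<close>

definition properly_infinite :: "'a \<Rightarrow> bool" where
  "properly_infinite v \<longleftrightarrow> v \<in> verts G \<and>
     (\<exists>W. finite W \<and> W \<subseteq> tree v \<and>
        (\<forall>w \<in> W. infinite (CSP w) \<or> 2 \<le> card (CSP w)) \<and>
        v \<in> hs_closure W)"

definition P_pi :: "'a set" where
  "P_pi = {v. properly_infinite v}"

definition breaking_set :: "'a set \<Rightarrow> 'a set" where
  "breaking_set H = {v \<in> verts G - H. infinite_emitter v \<and>
     finite {e \<in> out_arcs G v. head G e \<in> verts G - H} \<and>
     0 < card {e \<in> out_arcs G v. head G e \<in> verts G - H}}"

definition breaking_vertex :: "'a \<Rightarrow> bool" where
  "breaking_vertex v \<longleftrightarrow> (\<exists>H. hereditary H \<and> saturated H \<and> v \<in> breaking_set H)"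

definition P_ppi :: "'a set" where
  "P_ppi = {v \<in> verts G. tree v \<subseteq> P_pi \<and> (\<forall>u \<in> tree v. \<not> breaking_vertex u)}"

end

text \<open>
  The library notion \<^const>\<open>pre_digraph.cycle\<close> requires the ranges of the arcs to be
  distinct. For a closed path this is the same as requiring distinct sources.
\<close>

lemma (in wf_digraph) cas_heads_tails:
  "cas u p v \<Longrightarrow> u # map (head G) p = map (tail G) p @ [v]"
  by (induction p arbitrary: u) auto

lemma (in wf_digraph) cas_awalk_verts:
  "cas u p v \<Longrightarrow> awalk_verts u p = u # map (head G) p"
  by (induction p arbitrary: u) auto

lemma (in wf_digraph) cycle_iff_distinct_tails:
  "cycle p \<longleftrightarrow> p \<noteq> [] \<and> (\<exists>u. awalk u p u) \<and> distinct (map (tail G) p)"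
proof -
  have verts: "tl (awalk_verts u p) = map (head G) p" if "cas u p u" for u
    by (simp add: cas_awalk_verts[OF that])
  have "distinct (tl (awalk_verts u p)) \<longleftrightarrow> distinct (map (tail G) p)" if "awalk u p u" for u
  proof -
    from that have c: "cas u p u" by (simp add: awalk_def)
    have "mset (u # map (head G) p) = mset (map (tail G) p @ [u])"
      using cas_heads_tails[OF c] by simp
    then have "mset (map (head G) p) = mset (map (tail G) p)" by simp
    then show ?thesis unfolding verts[OF c] by (metis mset_eq_imp_distinct_iff)
  qed
  then show ?thesis unfolding cycle_def by blast
qed

lemma (in wf_digraph) hs_closure_least:
  assumes "X \<subseteq> verts G"
  shows "hereditary (hs_closure X)" "saturated (hs_closure X)" "X \<subseteq> hs_closure X"
    and "\<lbrakk>hereditary H; saturated H; X \<subseteq> H\<rbrakk> \<Longrightarrow> hs_closure X \<subseteq> H"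
proof -
  let ?F = "{H. hereditary H \<and> saturated H \<and> X \<subseteq> H}"
  have "verts G \<in> ?F"
    using assms reachable_in_verts(2)
    unfolding hereditary_def saturated_def regular_vertex_def by blast
  then have sub: "\<Inter>?F \<subseteq> verts G" by (rule Inter_lower)
  show "hereditary (hs_closure X)"
    unfolding hs_closure_def hereditary_def[of "\<Inter>?F"]
  proof (intro conjI allI impI sub InterI)
    fix v w H assume "v \<in> \<Inter>?F \<and> v \<rightarrow>\<^sup>*\<^bsub>G\<^esub> w" and "H \<in> ?F"
    then show "w \<in> H" unfolding hereditary_def by blast
  qed
  show "saturated (hs_closure X)"
    unfolding hs_closure_def saturated_def[of "\<Inter>?F"]
  proof (intro conjI allI impI sub InterI)
    fix v H assume "regular_vertex v \<and> head G ` out_arcs G v \<subseteq> \<Inter>?F" and H: "H \<in> ?F"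
    then have "regular_vertex v" "head G ` out_arcs G v \<subseteq> H" by blast+
    with H show "v \<in> H" unfolding saturated_def by blast
  qed
  show "X \<subseteq> hs_closure X" unfolding hs_closure_def by blast
  show "hs_closure X \<subseteq> H" if "hereditary H" "saturated H" "X \<subseteq> H"
    using that unfolding hs_closure_def by blast
qed

end

theory Submission
  imports Defs
begin

text \<open>
  The tree of a vertex \<open>v\<close> on an extreme cycle is strongly connected. Let \<open>w\<close> be the source of an
  exit. Both the exit and the cycle arc at \<open>w\<close> extend to closed simple paths based at \<open>w\<close>, so every
  vertex of the tree is properly infinite, witnessed by \<open>{w}\<close>. No vertex \<open>u\<close> of the tree is
  breaking: all arcs starting at \<open>u\<close> return to \<open>u\<close>, hence end outside every hereditary set that
  avoids \<open>u\<close>.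
\<close>

context wf_digraph
begin

lemma tree_mono: "v \<rightarrow>\<^sup>* u \<Longrightarrow> tree u \<subseteq> tree v"
  unfolding tree_def using reachable_trans by blast

lemma arc_reachable: "e \<in> out_arcs G v \<Longrightarrow> v \<rightarrow>\<^sup>* head G e"
  using in_arcs_imp_in_arcs_ends by fastforce

text \<open>A nontrivial path starts with an arc. This reduces a condition on the tree of
  \<open>v\<close> to \<open>v\<close> itself and the trees of its heads, the form in which
  saturation supplies it.\<close>

lemma tree_unfold:
  assumes "v \<in> verts G"
  shows "tree v = insert v (\<Union>e \<in> out_arcs G v. tree (head G e))"
proof (intro equalityI subsetI)
  fix u assume "u \<in> tree v"
  then have "v \<rightarrow>\<^sup>* u" and u: "u \<in> verts G" by (auto simp: tree_def)
  then show "u \<in> insert v (\<Union>e \<in> out_arcs G v. tree (head G e))"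
  proof (cases rule: converse_reachable_cases)
    case (step w)
    then obtain e where "e \<in> out_arcs G v" "head G e = w"
      by (auto simp: arcs_ends_conv)
    with step u show ?thesis by (auto simp: tree_def)
  qed simp
next
  fix u assume "u \<in> insert v (\<Union>e \<in> out_arcs G v. tree (head G e))"
  moreover have "tree (head G e) \<subseteq> tree v" if "e \<in> out_arcs G v" for e
    using that by (intro tree_mono arc_reachable)
  ultimately show "u \<in> tree v"
    using assms reachable_refl unfolding tree_def by blast
qed

lemma tree_subset_verts: "tree v \<subseteq> verts G"
  by (auto simp: tree_def)

text \<open>Both conditions quantify over the tree, and trees shrink along paths.\<close>

lemma hereditary_P_ppi: "hereditary P_ppi"
  unfolding hereditary_def P_ppi_def
  using tree_mono reachable_in_verts(2) by blast

text \<open>The union of witness sets chosen for the heads is a witness for \<open>v\<close>: it is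
  finite because a regular vertex emits finitely many arcs, and its closure contains all heads,
  hence \<open>v\<close> by saturation.\<close>

lemma properly_infinite_regular:
  assumes v: "regular_vertex v"
    and heads: "head G ` out_arcs G v \<subseteq> P_pi"
  shows "properly_infinite v"
proof -
  have vv: "v \<in> verts G" and fin: "finite (out_arcs G v)"
    using v by (auto simp: regular_vertex_def infinite_emitter_def)
  have "\<forall>e \<in> out_arcs G v. \<exists>W. finite W \<and> W \<subseteq> tree (head G e) \<and>
      (\<forall>w \<in> W. infinite (CSP w) \<or> 2 \<le> card (CSP w)) \<and> head G e \<in> hs_closure W"
    using heads unfolding P_pi_def properly_infinite_def by blast
  then obtain W where W: "\<And>e. e \<in> out_arcs G v \<Longrightarrow> finite (W e) \<and> W e \<subseteq> tree (head G e) \<and>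
      (\<forall>w \<in> W e. infinite (CSP w) \<or> 2 \<le> card (CSP w)) \<and> head G e \<in> hs_closure (W e)"
    by metis
  define U where "U = (\<Union>e \<in> out_arcs G v. W e)"
  have sub: "U \<subseteq> tree v"
    unfolding U_def using W by (subst tree_unfold[OF vv]) blast
  then have UV: "U \<subseteq> verts G"
    using tree_subset_verts by blast
  have "head G e \<in> hs_closure U" if e: "e \<in> out_arcs G v" for e
  proof -
    have "W e \<subseteq> U" using e by (auto simp: U_def)
    \<comment> \<open>The larger set \<open>U\<close> leaves fewer sets to intersect.\<close>
    then have "hs_closure (W e) \<subseteq> hs_closure U"
      unfolding hs_closure_def by blast
    with W[OF e] show ?thesis by blast
  qed
  then have "v \<in> hs_closure U"
    using hs_closure_least(2)[OF UV] v unfolding saturated_def by blast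
  moreover have "finite U" using fin W by (auto simp: U_def)
  moreover have "\<forall>w \<in> U. infinite (CSP w) \<or> 2 \<le> card (CSP w)"
    using W unfolding U_def by blast
  ultimately show ?thesis
    using vv sub unfolding properly_infinite_def by blast
qed

lemma saturated_P_ppi: "saturated P_ppi"
  unfolding saturated_def
proof (intro conjI allI impI)
  show "P_ppi \<subseteq> verts G" by (auto simp: P_ppi_def)
next
  fix v assume "regular_vertex v \<and> head G ` out_arcs G v \<subseteq> P_ppi"
  then have v: "regular_vertex v" and heads: "head G ` out_arcs G v \<subseteq> P_ppi" by auto
  have vv: "v \<in> verts G" using v by (simp add: regular_vertex_def)
  have sub: "P_ppi \<subseteq> P_pi"
    by (auto simp: P_ppi_def tree_def)
  have "v \<in> P_pi"
    using properly_infinite_regular[OF v] heads sub unfolding P_pi_def by blast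
  \<comment> \<open>Breaking vertices are infinite emitters.\<close>
  moreover have "\<not> breaking_vertex v"
    using v by (auto simp: breaking_vertex_def breaking_set_def regular_vertex_def)
  ultimately have "u \<in> P_pi \<and> \<not> breaking_vertex u" if "u \<in> tree v" for u
    using that heads by (auto simp: tree_unfold[OF vv] P_ppi_def)
  with vv show "v \<in> P_ppi" by (auto simp: P_ppi_def)
qed

text \<open>Return along a path without repeated vertices: it visits the base only at its end, so
  none of its arcs starts there.\<close>

lemma CSP_from_arc:
  assumes e: "e \<in> arcs G" and ret: "head G e \<rightarrow>\<^sup>* tail G e"
  obtains p where "e # p \<in> CSP (tail G e)"
proof -
  obtain p where p: "apath (head G e) p (tail G e)"
    using ret unfolding reachable_apath by blast
  then have aw: "awalk (head G e) p (tail G e)" and dist: "distinct (awalk_verts (head G e) p)"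
    by (auto simp: apath_def)
  have "cas (head G e) p (tail G e)" using aw by (simp add: awalk_def)
  then have "awalk_verts (head G e) p = map (tail G) p @ [tail G e]"
    by (simp add: cas_awalk_verts cas_heads_tails)
  with dist have "tail G e \<notin> tail G ` set p" by simp
  then have "\<forall>a \<in> set p. tail G a \<noteq> tail G e" by (metis imageI)
  moreover have "awalk (tail G e) (e # p) (tail G e)"
    using aw e by (simp add: awalk_Cons_iff)
  ultimately show thesis
    using that by (simp add: CSP_def)
qed

lemma two_CSPs:
  assumes "e \<in> arcs G" "head G e \<rightarrow>\<^sup>* w" "tail G e = w"
    and "f \<in> arcs G" "head G f \<rightarrow>\<^sup>* w" "tail G f = w"
    and "e \<noteq> f"
  shows "infinite (CSP w) \<or> 2 \<le> card (CSP w)"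
proof -
  obtain p q where "e # p \<in> CSP w" "f # q \<in> CSP w"
    using assms CSP_from_arc by metis
  then have "{e # p, f # q} \<subseteq> CSP w" by simp
  moreover have "card {e # p, f # q} = 2" using \<open>e \<noteq> f\<close> by simp
  \<comment> \<open>\<open>card_mono\<close> covers finite \<open>CSP w\<close>; otherwise the first
    disjunct holds.\<close>
  ultimately show ?thesis by (metis card_mono)
qed

text \<open>Both vertices lie on one closed walk, so \<open>x\<close> reaches its base and the base
  reaches \<open>y\<close>.\<close>

lemma cycle_verts_reachable:
  assumes "cycle c" "x \<in> cycle_verts c" "y \<in> cycle_verts c"
  shows "x \<rightarrow>\<^sup>* y"
proof -
  obtain u where u: "awalk u c u" using assms(1) by (auto simp: cycle_def)
  have "cycle_verts c \<subseteq> set (awalk_verts u c)"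
    using u by (auto simp: cycle_verts_def set_awalk_verts)
  then show ?thesis
    using assms(2,3) u awalk_verts_reachable_from awalk_verts_reachable_to reachable_trans
    by blast
qed

text \<open>Extremeness only gives a return to some vertex of the cycle; from there the cycle itself
  leads to the prescribed \<open>y\<close>.\<close>

lemma extreme_cycle_return:
  assumes c: "extreme_cycle c" and x: "x \<in> cycle_verts c" and y: "y \<in> cycle_verts c"
    and u: "x \<rightarrow>\<^sup>* u"
  shows "u \<rightarrow>\<^sup>* y"
proof -
  have cyc: "cycle c" using c by (simp add: extreme_cycle_def)
  obtain z where "z \<in> cycle_verts c" "u \<rightarrow>\<^sup>* z"
    using c x u unfolding extreme_cycle_def reachable_awalk by blast
  then show ?thesis
    using cycle_verts_reachable[OF cyc _ y] reachable_trans by blast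
qed

lemma not_breaking_vertex:
  assumes ret: "\<And>e. e \<in> out_arcs G u \<Longrightarrow> head G e \<rightarrow>\<^sup>* u"
  shows "\<not> breaking_vertex u"
proof
  assume "breaking_vertex u"
  then obtain H where H: "hereditary H" and u: "u \<in> breaking_set H"
    by (auto simp: breaking_vertex_def)
  then have "infinite (out_arcs G u)"
    and "finite {e \<in> out_arcs G u. head G e \<in> verts G - H}"
    by (auto simp only: breaking_set_def infinite_emitter_def)
  \<comment> \<open>A head in \<open>H\<close> would force \<open>u\<close> into \<open>H\<close> by
    heredity. So the arcs ending outside \<open>H\<close> are all of the infinitely many arcs at
    \<open>u\<close>, against their finiteness.\<close>
  moreover have "head G e \<in> verts G - H" if "e \<in> out_arcs G u" for e
    using that ret[OF that] H u unfolding hereditary_def breaking_set_def by auto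
  then have "{e \<in> out_arcs G u. head G e \<in> verts G - H} = out_arcs G u" by blast
  ultimately show False by simp
qed

lemma P_ec_subset_P_ppi: "P_ec \<subseteq> P_ppi"
proof
  fix v assume "v \<in> P_ec"
  then obtain c where c: "extreme_cycle c" and v: "v \<in> cycle_verts c"
    by (auto simp: P_ec_def)
  have cyc: "cycle c" using c by (simp add: extreme_cycle_def)
  obtain e f where e: "e \<in> arcs G" and f: "f \<in> set c"
    and tails: "tail G e = tail G f" and ne: "e \<noteq> f"
    using c unfolding extreme_cycle_def exit_of_def by blast
  define w where "w = tail G f"
  have w: "w \<in> cycle_verts c" using f by (auto simp: w_def cycle_verts_def)
  have f': "f \<in> arcs G" using cyc f by (auto simp: cycle_def awalk_def)
  have ret: "head G a \<rightarrow>\<^sup>* w" if "a \<in> arcs G" "tail G a = w" for a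
    using extreme_cycle_return[OF c w w arc_reachable] that by simp
  have csp: "infinite (CSP w) \<or> 2 \<le> card (CSP w)"
  proof (rule two_CSPs)
    show "tail G e = w" "tail G f = w" by (simp_all add: w_def tails)
    then show "head G e \<rightarrow>\<^sup>* w" "head G f \<rightarrow>\<^sup>* w" by (simp_all only: ret e f')
  qed (fact e f' ne)+
  have vv: "v \<in> verts G"
    using cycle_verts_reachable[OF cyc v v] reachable_in_verts(1) by blast
  have "u \<in> P_pi \<and> \<not> breaking_vertex u" if "u \<in> tree v" for u
  proof
    have vu: "v \<rightarrow>\<^sup>* u" using that by (simp add: tree_def)
    have uw: "u \<rightarrow>\<^sup>* w" by (rule extreme_cycle_return[OF c v w vu])
    have wu: "w \<rightarrow>\<^sup>* u"
      using cycle_verts_reachable[OF cyc w v] vu reachable_trans by blast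
    have wV: "{w} \<subseteq> verts G" using uw reachable_in_verts(2) by blast
    \<comment> \<open>Since \<open>w\<close> reaches \<open>u\<close>, heredity of the closure
      suffices.\<close>
    have "u \<in> hs_closure {w}"
      using hs_closure_least(1,3)[OF wV] wu unfolding hereditary_def by blast
    moreover have "{w} \<subseteq> tree u" using uw wV by (simp add: tree_def)
    moreover have "u \<in> verts G" by (rule reachable_in_verts(2)[OF vu])
    ultimately show "u \<in> P_pi"
      using csp by (auto simp: P_pi_def properly_infinite_def intro!: exI[of _ "{w}"])
    \<comment> \<open>As \<open>u\<close> may lie off the cycle, the return goes through
      \<open>v\<close>, which lies on it.\<close>
    have "head G a \<rightarrow>\<^sup>* u" if "a \<in> out_arcs G u" for a
    proof -
      have "u \<rightarrow>\<^sup>* head G a" using that by (rule arc_reachable)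
      with vu have "v \<rightarrow>\<^sup>* head G a" by (rule reachable_trans)
      then have "head G a \<rightarrow>\<^sup>* v" by (rule extreme_cycle_return[OF c v v])
      then show ?thesis using vu by (rule reachable_trans)
    qed
    then show "\<not> breaking_vertex u" by (rule not_breaking_vertex)
  qed
  then show "v \<in> P_ppi" using vv by (auto simp: P_ppi_def)
qed

end

theorem lemma4p10:
  fixes G :: "('v, 'e) pre_digraph"
  assumes "wf_digraph G"
  shows "pre_digraph.hereditary G (pre_digraph.P_ppi G) \<and>
           pre_digraph.saturated G (pre_digraph.P_ppi G) \<and>
           pre_digraph.P_ec G \<subseteq> pre_digraph.P_ppi G"
  using wf_digraph.hereditary_P_ppi[OF assms] wf_digraph.saturated_P_ppi[OF assms]
    wf_digraph.P_ec_subset_P_ppi[OF assms]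
  by blast

end
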